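(* For all integers $m,k\ge 0$, $$\zeta(\bar 1,\{1\}_m,\bar 1,\{1\}_k)=\frac{(-1)^{m+k+1}}{k!}\sum_{j=0}^{k}(-1)^j(\ln 2)^{k-j}j!\binom{k}{j}\left\{\zeta(m+2,\{1\}_j)-\sum_{l=0}^{m+1}\frac{(\ln 2)^{m+1-l}}{(m+1-l)!}\mathrm{Li}_{l+1,\{1\}_j}\!\left(\tfrac12\right)\right\}.$$
   Context: For nonzero integers $s_1,\dots,s_k$, with $\operatorname{sgn}(s)=1$ if $s>0$ and $-1$ if $s<0$, the multiple zeta value is $\zeta(s_1,\dots,s_k)=\sum_{n_1>n_2>\cdots>n_k\ge 1}\prod_{j=1}^k n_j^{-|s_j|}\operatorname{sgn}(s_j)^{n_j}$. A barred entry $\bar p$ denotes the negative entry $-p$. The notation $\{1\}_d$ means the entry $1$ repeated $d$ times ($d=0$ means no entries). For positive integers $s_1,\dots,s_r$ and $0\le x<1$, the multiple polylogarithm is $\mathrm{Li}_{s_1,\dots,s_r}(x)=\sum_{n_1>\cdots>n_r>0}\frac{x^{n_1}}{n_1^{s_1}\cdots n_r^{s_r}}$. *)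

theory Defs
  imports Complex_Main
begin

fun mzv_partial :: "int list \<Rightarrow> nat \<Rightarrow> real" where
  "mzv_partial [] N = 1"
| "mzv_partial (s # ss) N =
     (\<Sum>n\<in>{1..<N}. (real_of_int (sgn s)) ^ n / real n ^ nat \<bar>s\<bar> * mzv_partial ss n)"

definition mzv :: "int list \<Rightarrow> real" where
  "mzv s = lim (\<lambda>N. mzv_partial s N)"

fun mpl_partial :: "nat list \<Rightarrow> real \<Rightarrow> nat \<Rightarrow> real" where
  "mpl_partial [] x N = 1"
| "mpl_partial (s # ss) x N =
     (\<Sum>n\<in>{1..<N}. x ^ n / real n ^ s * mzv_partial (map int ss) n)"

definition Li :: "nat list \<Rightarrow> real \<Rightarrow> real" where
  "Li s x = lim (\<lambda>N. mpl_partial s x N)"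

end

theory Submission
  imports Defs "HOL-Analysis.Analysis" "HOL-Real_Asymp.Real_Asymp"
begin

text \<open>
  Both sides are boundary values of sums of power series in one variable. With
  \<open>y = (1 + x) / 2\<close>, the generating series of the left-hand side solve
  \<open>f\<^sub>i\<^sub>+\<^sub>1' = f\<^sub>i / (1 - y)\<close>, \<open>f\<^sub>0 = (- ln (2 y))\<^sup>k\<^sup>+\<^sup>1 / (k + 1)!\<close>, and
  \<open>T(y) = \<Sum>\<^sub>i ln(1 - y)\<^sup>M\<^sup>-\<^sup>i / (M - i)! f\<^sub>i(y)\<close> with \<open>M = m + 1\<close> has derivative
  \<open>- ln(1 - y)\<^sup>M / M! (- ln (2 y))\<^sup>k / (k! y)\<close> because the sum telescopes. The same telescoping
  shows that \<open>B\<^sub>j(z) = \<Sum>\<^sub>l (- ln z)\<^sup>M\<^sup>-\<^sup>l / (M - l)! Li\<^sub>l\<^sub>+\<^sub>1\<^sub>,\<^sub>1\<^sub>,\<^sub>\<dots>\<^sub>,\<^sub>1(z)\<close> has derivative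
  \<open>(- ln z)\<^sup>M / M! (- ln (1 - z))\<^sup>j / (j! (1 - z))\<close>. Expanding \<open>(- ln y - ln 2)\<^sup>k\<close> binomially,
  \<open>T(y)\<close> minus a linear combination of the \<open>B\<^sub>j(1 - y)\<close> is constant on \<open>(0, 1)\<close>. Its limit at
  \<open>y = 0\<close> involves the multiple zeta values and its value at \<open>y = 1/2\<close>, where \<open>T\<close> vanishes, the
  polylogarithms.
\<close>

section \<open>Multiple zeta and polylogarithm sums as series\<close>

text \<open>The base case is the power series \<open>1\<close>, so that \<^const>\<open>mzv_partial\<close> is a sum of terms also for the
  empty list. For nonzero entries the term at \<open>n = 0\<close> is a junk division by zero, hence \<open>0\<close>.\<close>
fun mzv_term :: "int list \<Rightarrow> nat \<Rightarrow> real" where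
  "mzv_term [] n = (if n = 0 then 1 else 0)"
| "mzv_term (s # ss) n = real_of_int (sgn s) ^ n / real n ^ nat \<bar>s\<bar> * mzv_partial ss n"

text \<open>The power \<open>x ^ n\<close> carries the outermost, largest summation index only; the
  signs of inner entries stay in the coefficients.\<close>

definition polylog :: "int list \<Rightarrow> real \<Rightarrow> real" where
  "polylog s x = (\<Sum>n. mzv_term s n * x ^ n)"

lemma mzv_term_Cons_0 [simp]: "s \<noteq> 0 \<Longrightarrow> mzv_term (s # ss) 0 = 0"
  by simp

lemma sum_from_1_eq_lessThan:
  fixes f :: "nat \<Rightarrow> real"
  assumes "f 0 = 0"
  shows "sum f {1..<Suc N} = sum f {..<Suc N}"
proof -
  have "{..<Suc N} = insert 0 {1..<Suc N}"
    by auto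
  then show ?thesis
    using assms by simp
qed

text \<open>Stated at \<open>Suc N\<close> because index 0 fails for the empty list:
  \<open>mzv_partial [] 0\<close> is 1, whereas the empty sum of terms is 0.\<close>

lemma mzv_partial_Suc:
  assumes "0 \<notin> set s"
  shows "mzv_partial s (Suc N) = (\<Sum>n<Suc N. mzv_term s n)"
proof (cases s)
  case Nil
  have "(\<Sum>n<Suc N. mzv_term [] n) = 1"
    by (induction N) auto
  then show ?thesis
    using Nil by simp
next
  case (Cons a ss)
  then have "mzv_partial s (Suc N) = (\<Sum>n\<in>{1..<Suc N}. mzv_term (a # ss) n)"
    by simp
  also have "\<dots> = (\<Sum>n<Suc N. mzv_term (a # ss) n)"
    using assms Cons by (intro sum_from_1_eq_lessThan mzv_term_Cons_0) auto
  finally show ?thesis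
    using Cons by simp
qed

lemma mpl_partial_Suc:
  assumes "0 \<notin> set s"
  shows "mpl_partial s x (Suc N) = (\<Sum>n<Suc N. mzv_term (map int s) n * x ^ n)"
proof (cases s)
  case Nil
  have "(\<Sum>n<Suc N. mzv_term [] n * x ^ n) = 1"
    by (induction N) auto
  then show ?thesis
    using Nil by simp
next
  case (Cons a ss)
  with assms have "a \<noteq> 0"
    by auto
  then have "mpl_partial s x (Suc N) = (\<Sum>n\<in>{1..<Suc N}. mzv_term (map int (a # ss)) n * x ^ n)"
    using Cons by (simp add: mult_ac)
  also have "\<dots> = (\<Sum>n<Suc N. mzv_term (map int (a # ss)) n * x ^ n)"
    using \<open>a \<noteq> 0\<close> by (intro sum_from_1_eq_lessThan) auto
  finally show ?thesis
    using Cons by simp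
qed

lemma mzv_eqI:
  assumes "0 \<notin> set s" "mzv_term s sums l"
  shows "mzv s = l"
proof -
  have "(\<lambda>N. mzv_partial s (Suc N)) \<longlonglongrightarrow> l"
    using assms(2) unfolding mzv_partial_Suc[OF assms(1)] sums_def by (rule LIMSEQ_Suc)
  then show ?thesis
    unfolding mzv_def by (intro limI) (simp only: filterlim_sequentially_Suc)
qed

section \<open>Logarithmic growth bounds and summability\<close>

lemma sum_inverse_le_ln:
  assumes "n > 0"
  shows "(\<Sum>i\<in>{1..<n}. 1 / real i) \<le> 1 + ln (real n)"
proof -
  have "(\<Sum>i\<in>{1..<n}. 1 / real i) \<le> harm n"
    unfolding harm_def by (simp add: inverse_eq_divide) (intro sum_mono2; auto)
  also have "\<dots> \<le> 1 + ln (real n)"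
    using euler_mascheroni_sequence_decreasing[of 1 n] assms by (simp add: harm_expand)
  finally show ?thesis .
qed

lemma abs_sgn_quotient_le:
  assumes "s \<noteq> 0"
  shows "\<bar>real_of_int (sgn s) ^ n / real n ^ nat \<bar>s\<bar>\<bar> \<le> 1 / real n"
proof (cases "n = 0")
  case True
  with assms show ?thesis
    by (simp add: power_0_left)
next
  case False
  have "\<bar>real_of_int (sgn s) ^ n\<bar> = 1"
    using assms by (auto simp: power_abs sgn_if)
  moreover have "real n ^ 1 \<le> real n ^ nat \<bar>s\<bar>"
    using False assms by (intro power_increasing) auto
  ultimately show ?thesis
    using False by (simp add: frac_le)
qed

text \<open>Holds even at \<open>n = 0\<close>, by the convention \<open>ln 0 = 0\<close>.\<close>

lemma one_le_one_plus_ln: "1 \<le> 1 + ln (real n)"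
  by (cases n) auto

text \<open>Each nested summation costs at most one harmonic number, hence one factor
  \<open>1 + ln n\<close>.\<close>

lemma abs_mzv_partial_le:
  assumes "0 \<notin> set s"
  shows "\<bar>mzv_partial s n\<bar> \<le> (1 + ln (real n)) ^ length s"
  using assms
proof (induction s arbitrary: n)
  case Nil
  then show ?case
    by simp
next
  case (Cons a ss)
  show ?case
  proof (cases "n = 0")
    case True
    then show ?thesis
      by simp
  next
    case False
    have "\<bar>mzv_partial (a # ss) n\<bar> \<le> (\<Sum>i\<in>{1..<n}. 1 / real i * (1 + ln (real n)) ^ length ss)"
      unfolding mzv_partial.simps
    proof (rule order_trans[OF sum_abs sum_mono])
      fix i assume i: "i \<in> {1..<n}"
      have "\<bar>mzv_partial ss i\<bar> \<le> (1 + ln (real i)) ^ length ss"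
        using Cons by auto
      also have "\<dots> \<le> (1 + ln (real n)) ^ length ss"
        using i by (intro power_mono) auto
      finally show "\<bar>real_of_int (sgn a) ^ i / real i ^ nat \<bar>a\<bar> * mzv_partial ss i\<bar>
          \<le> 1 / real i * (1 + ln (real n)) ^ length ss"
        unfolding abs_mult using Cons.prems
        by (intro mult_mono abs_sgn_quotient_le) auto
    qed
    also have "\<dots> = (\<Sum>i\<in>{1..<n}. 1 / real i) * (1 + ln (real n)) ^ length ss"
      by (simp add: sum_distrib_right)
    also have "\<dots> \<le> (1 + ln (real n)) * (1 + ln (real n)) ^ length ss"
      using False one_le_one_plus_ln[of n]
      by (intro mult_right_mono sum_inverse_le_ln zero_le_power) auto
    finally show ?thesis
      by simp
  qed
qed

lemma abs_mzv_term_Cons_le: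
  assumes "0 \<notin> set (s # ss)"
  shows "\<bar>mzv_term (s # ss) n\<bar> \<le> (1 + ln (real n)) ^ length ss / real n"
proof -
  have "\<bar>mzv_term (s # ss) n\<bar> \<le> 1 / real n * (1 + ln (real n)) ^ length ss"
    unfolding mzv_term.simps abs_mult using assms
    by (intro mult_mono abs_sgn_quotient_le abs_mzv_partial_le) auto
  then show ?thesis
    by simp
qed

lemma abs_mzv_term_le:
  assumes "0 \<notin> set s"
  shows "\<bar>mzv_term s n\<bar> \<le> (1 + ln (real n)) ^ length s"
proof (cases s)
  case Nil
  then show ?thesis
    by simp
next
  case (Cons a ss)
  have "\<bar>mzv_term s n\<bar> \<le> (1 + ln (real n)) ^ length ss / real n"
    using abs_mzv_term_Cons_le assms Cons by metis
  also have "\<dots> \<le> (1 + ln (real n)) ^ length ss"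
  proof (cases "n = 0")
    case False
    then show ?thesis
      using one_le_one_plus_ln[of n] frac_le[of "(1 + ln (real n)) ^ length ss" "(1 + ln (real n)) ^ length ss" 1 "real n"] by simp
  qed simp
  also have "\<dots> \<le> (1 + ln (real n)) ^ length s"
    using Cons one_le_one_plus_ln[of n] by (intro power_increasing) auto
  finally show ?thesis .
qed

lemma summable_one_plus_ln_power_div_square:
  "summable (\<lambda>n. (1 + ln (real n)) ^ p / real n ^ 2)"
proof (rule summable_comparison_test_bigo)
  \<comment> \<open>Any exponent strictly between 1 and 2 leaves room to absorb the
    logarithms.\<close>
  show "summable (\<lambda>n. norm (real n powr (- 3 / 2)))"
    by (simp add: summable_real_powr_iff)
  show "(\<lambda>n. (1 + ln (real n)) ^ p / real n ^ 2) \<in> O(\<lambda>n. real n powr (- 3 / 2))"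
    by real_asymp
qed

lemma summable_powser_mzv_partial:
  assumes "0 \<notin> set s" "\<bar>x\<bar> < 1"
  shows "summable (\<lambda>n. mzv_partial s (Suc n) * x ^ n)" (is ?th1)
    and "summable (\<lambda>n. mzv_term s n * x ^ n)" (is ?th2)
proof -
  \<comment> \<open>The midpoint of |x| and 1 is positive even for \<open>x = 0\<close>; the
    geometric decay of its powers beats the logarithmic growth of the coefficients.\<close>
  define r where "r = (1 + \<bar>x\<bar>) / 2"
  have r: "0 < r" "r < 1" "norm x < norm r"
    using assms(2) by (auto simp: r_def)
  have sm: "summable (\<lambda>n. (1 + ln (real (Suc n))) ^ length s * r ^ n)"
  proof (rule summable_comparison_test_bigo)
    show "summable (\<lambda>n. norm (real n powr (- 3 / 2)))"
      by (simp add: summable_real_powr_iff)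
    show "(\<lambda>n. (1 + ln (real (Suc n))) ^ length s * r ^ n) \<in> O(\<lambda>n. real n powr (- 3 / 2))"
      using r by real_asymp
  qed
  have "summable (\<lambda>n. mzv_partial s (Suc n) * r ^ n)"
  proof (rule summable_comparison_test[OF _ sm], intro exI allI impI)
    fix n :: nat
    show "norm (mzv_partial s (Suc n) * r ^ n) \<le> (1 + ln (real (Suc n))) ^ length s * r ^ n"
      using abs_mzv_partial_le[OF assms(1), of "Suc n"] r(1) by (simp add: abs_mult)
  qed
  then show ?th1
    using r by (rule_tac powser_inside)
  have "summable (\<lambda>n. mzv_term s n * r ^ n)"
  proof (rule summable_comparison_test[OF _ sm], intro exI allI impI)
    fix n :: nat
    have "\<bar>mzv_term s n\<bar> \<le> (1 + ln (real n)) ^ length s"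
      by (rule abs_mzv_term_le[OF assms(1)])
    also have "\<dots> \<le> (1 + ln (real (Suc n))) ^ length s"
      using one_le_one_plus_ln[of n] by (intro power_mono) (cases n; auto)+
    finally show "norm (mzv_term s n * r ^ n) \<le> (1 + ln (real (Suc n))) ^ length s * r ^ n"
      using r(1) by (simp add: abs_mult)
  qed
  then show ?th2
    using r by (rule_tac powser_inside)
qed

lemma Li_eq_polylog:
  assumes "0 \<notin> set s" "\<bar>x\<bar> < 1"
  shows "Li s x = polylog (map int s) x"
proof -
  have "(\<lambda>n. mzv_term (map int s) n * x ^ n) sums polylog (map int s) x"
    unfolding polylog_def
    using assms by (intro summable_sums summable_powser_mzv_partial) auto
  then have "(\<lambda>N. mpl_partial s x (Suc N)) \<longlonglongrightarrow> polylog (map int s) x"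
    unfolding mpl_partial_Suc[OF assms(1)] sums_def by (rule LIMSEQ_Suc)
  then show ?thesis
    unfolding Li_def by (intro limI) (simp only: filterlim_sequentially_Suc)
qed

section \<open>Power series tools and differential equations for polylogarithms\<close>

text \<open>Backward differences turn partial sums into terms in the differential equation, and give
  absolute summability near -1.\<close>

lemma one_minus_times_powser_sums:
  fixes c :: "nat \<Rightarrow> real"
  assumes "summable (\<lambda>n. c n * x ^ n)"
  shows "(\<lambda>n. (c n - (if n = 0 then 0 else c (n - 1))) * x ^ n) sums ((1 - x) * (\<Sum>n. c n * x ^ n))"
proof -
  let ?S = "\<Sum>n. c n * x ^ n"
  have "(\<lambda>n. c n * x ^ n) sums ?S"
    using assms by (rule summable_sums)
  then have "(\<lambda>n. x * (c n * x ^ n)) sums (x * ?S)"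
    by (rule sums_mult)
  then have "(\<lambda>n. (if Suc n = 0 then 0 else c (Suc n - 1)) * x ^ Suc n) sums (x * ?S)"
    by (simp add: mult_ac)
  then have "(\<lambda>n. (if n = 0 then 0 else c (n - 1)) * x ^ n) sums (x * ?S)"
    by (subst (asm) sums_Suc_iff) simp
  from sums_diff[OF summable_sums[OF assms] this] show ?thesis
    by (simp add: algebra_simps)
qed

lemma continuous_on_powser_abs_summable:
  fixes c :: "nat \<Rightarrow> real"
  assumes "summable (\<lambda>n. \<bar>c n\<bar>)"
  shows "continuous_on {-1..1} (\<lambda>x. \<Sum>n. c n * x ^ n)"
proof (rule uniform_limit_theorem)
  show "\<forall>\<^sub>F n in sequentially. continuous_on {-1..1} (\<lambda>x. \<Sum>i<n. c i * x ^ i)"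
    by (intro always_eventually allI continuous_intros)
  show "uniform_limit {-1..1} (\<lambda>n x. \<Sum>i<n. c i * x ^ i) (\<lambda>x. \<Sum>n. c n * x ^ n) sequentially"
  proof (rule Weierstrass_m_test[OF _ assms])
    fix n and x :: real
    assume "x \<in> {-1..1}"
    then have "\<bar>x\<bar> ^ n \<le> 1"
      by (intro power_le_one) auto
    then show "norm (c n * x ^ n) \<le> \<bar>c n\<bar>"
      by (simp add: abs_mult power_abs mult_left_le)
  qed
qed simp

lemma polylog_0: "s \<noteq> 0 \<Longrightarrow> polylog (s # ss) 0 = 0"
  unfolding polylog_def by (subst powser_zero) simp

lemma polylog_minus_one: "polylog (-1 # ss) x = polylog (1 # ss) (- x)"
  unfolding polylog_def by (intro suminf_cong) (simp add: power_minus[of x] mult_ac)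

text \<open>Differentiation cancels the outer 1/n and leaves the partial sums of \<open>ss\<close>
  as coefficients; multiplying by 1 - x takes their differences, which are the terms of
  \<open>ss\<close>.\<close>

lemma has_real_derivative_polylog_one:
  assumes "0 \<notin> set ss" "\<bar>x\<bar> < 1"
  shows "(polylog (1 # ss) has_real_derivative polylog ss x / (1 - x)) (at x)"
proof -
  have "diffs (mzv_term (1 # ss)) = (\<lambda>n. mzv_partial ss (Suc n))"
    by (simp add: diffs_def fun_eq_iff)
  moreover have "(polylog (1 # ss) has_real_derivative (\<Sum>n. diffs (mzv_term (1 # ss)) n * x ^ n)) (at x)"
    unfolding polylog_def[abs_def] using assms
    by (intro termdiffs_strong'[where K = 1] summable_powser_mzv_partial) auto
  moreover have "(1 - x) * (\<Sum>n. mzv_partial ss (Suc n) * x ^ n) = polylog ss x"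
  proof -
    have "mzv_partial ss (Suc n) - (if n = 0 then 0 else mzv_partial ss (Suc (n - 1))) = mzv_term ss n" for n
      using mzv_partial_Suc[OF assms(1), of n] mzv_partial_Suc[OF assms(1), of "n - 1"]
      by (cases n) simp_all
    then show ?thesis
      using one_minus_times_powser_sums[OF summable_powser_mzv_partial(1)[OF assms]]
      by (simp add: polylog_def sums_iff)
  qed
  ultimately show ?thesis
    using assms(2) nonzero_mult_div_cancel_left[of "1 - x" "\<Sum>n. mzv_partial ss (Suc n) * x ^ n"]
    by simp
qed

text \<open>Differentiation lowers the outer exponent by one. For \<open>p > 0\<close> the constant
  coefficient of the lower series vanishes, so a factor x can be split off.\<close>

lemma has_real_derivative_polylog_Suc:
  assumes "0 \<notin> set ss" "p > 0" "\<bar>x\<bar> < 1" "x \<noteq> 0"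
  shows "(polylog (int (Suc p) # ss) has_real_derivative polylog (int p # ss) x / x) (at x)"
proof -
  have "diffs (mzv_term (int (Suc p) # ss)) n = mzv_term (int p # ss) (Suc n)" for n
    using assms(2) by (simp add: diffs_def nat_add_distrib)
  moreover have "(polylog (int (Suc p) # ss) has_real_derivative
      (\<Sum>n. diffs (mzv_term (int (Suc p) # ss)) n * x ^ n)) (at x)"
    unfolding polylog_def[abs_def] using assms
    by (intro termdiffs_strong'[where K = 1] summable_powser_mzv_partial) auto
  moreover have "x * (\<Sum>n. mzv_term (int p # ss) (Suc n) * x ^ n) = polylog (int p # ss) x"
    using powser_split_head(1)[OF summable_powser_mzv_partial(2)[of "int p # ss" x]] assms
    by (simp add: polylog_def mult_ac del: mzv_term.simps)
  ultimately show ?thesis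
    using assms(4)
      nonzero_mult_div_cancel_left[of x "\<Sum>n. mzv_term (int p # ss) (Suc n) * x ^ n"]
    by (simp del: mzv_term.simps of_nat_Suc)
qed

lemma has_real_derivative_power_div_fact:
  assumes "(f has_real_derivative d) (at x)"
  shows "((\<lambda>x. f x ^ Suc k / fact (Suc k)) has_real_derivative f x ^ k / fact k * d) (at x)"
proof -
  have "(1 + real k) * (d * f x ^ k) / fact (Suc k) = f x ^ k / fact k * d"
    by (simp add: divide_simps)
  then show ?thesis
    using DERIV_cdivide[OF DERIV_power_Suc[OF assms, of k], of "fact (Suc k)"]
    by (simp only: of_nat_Suc)
qed

lemma has_real_derivative_ln_one_minus:
  assumes "x < 1"
  shows "((\<lambda>x. ln (1 - x)) has_real_derivative - (1 / (1 - x))) (at x)"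
  using assms by (auto intro!: derivative_eq_intros simp: divide_simps)

text \<open>For \<open>Suc k\<close> both sides vanish at 0 and, by induction, have the same
  derivative.\<close>

lemma polylog_replicate_one:
  assumes "\<bar>x\<bar> < 1"
  shows "polylog (replicate k 1) x = (- ln (1 - x)) ^ k / fact k"
  using assms
proof (induction k arbitrary: x)
  case 0
  have "polylog [] x = (\<Sum>n. if n = 0 then 1 else 0)"
    unfolding polylog_def by (intro suminf_cong) auto
  then show ?case
    using sums_single[of 0 "\<lambda>_. 1 :: real"] by (simp add: sums_iff)
next
  case (Suc k)
  let ?D = "\<lambda>x. polylog (1 # replicate k 1) x - (- ln (1 - x)) ^ Suc k / fact (Suc k)"
  have "?D x = ?D 0"
  proof (rule DERIV_isconst3[of "-1" 1 x 0 ?D])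
    fix y :: real
    assume y: "y \<in> {-1<..<1}"
    have "((\<lambda>x. (- ln (1 - x)) ^ Suc k / fact (Suc k)) has_real_derivative
        (- ln (1 - y)) ^ k / fact k / (1 - y)) (at y)"
      using has_real_derivative_power_div_fact[of "\<lambda>x. - ln (1 - x)" "1 / (1 - y)" y k]
        has_real_derivative_ln_one_minus[of y] y by (auto dest: DERIV_minus)
    moreover have "(polylog (1 # replicate k 1) has_real_derivative
        (- ln (1 - y)) ^ k / fact k / (1 - y)) (at y)"
      using has_real_derivative_polylog_one[of "replicate k 1" y] Suc.IH[of y] y by auto
    ultimately show "(?D has_real_derivative 0) (at y)"
      using DERIV_diff by fastforce
  qed (use Suc.prems in auto)
  then show ?case
    by (simp add: polylog_0)
qed

section \<open>Boundary values at 1 and -1\<close>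

text \<open>With outer exponent at least 2 the series converges absolutely at 1, so the Weierstrass
  test gives continuity up to the boundary.\<close>

lemma polylog_tendsto_mzv:
  assumes "0 \<notin> set ss" "p \<ge> 2"
  shows "(polylog (int p # ss) \<longlongrightarrow> mzv (int p # ss)) (at_left 1)"
proof -
  have sm: "summable (\<lambda>n. \<bar>mzv_term (int p # ss) n\<bar>)"
  proof (rule summable_comparison_test'[OF summable_one_plus_ln_power_div_square])
    fix n :: nat
    assume "n \<ge> 1"
    then have "real n ^ 2 \<le> real n ^ p"
      using assms(2) by (intro power_increasing) auto
    then have "\<bar>mzv_partial ss n\<bar> / real n ^ p \<le> (1 + ln (real n)) ^ length ss / real n ^ 2"
      using \<open>n \<ge> 1\<close> abs_mzv_partial_le[OF assms(1), of n] by (intro frac_le) auto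
    then show "norm \<bar>mzv_term (int p # ss) n\<bar> \<le> (1 + ln (real n)) ^ length ss / real n ^ 2"
      using assms(2) by (simp add: abs_mult)
  qed
  have "(polylog (int p # ss) \<longlongrightarrow> polylog (int p # ss) 1) (at 1 within {-1..1})"
    using continuous_on_powser_abs_summable[OF sm] unfolding polylog_def[abs_def] continuous_on
    by (rule bspec) simp
  moreover have "mzv (int p # ss) = polylog (int p # ss) 1"
    using assms summable_sums[OF summable_rabs_cancel[OF sm]]
    by (intro mzv_eqI) (auto simp: polylog_def simp del: mzv_term.simps)
  moreover have "at 1 within {-1..1} = at_left (1 :: real)"
    by (rule at_within_Icc_at_left) simp
  ultimately show ?thesis
    by (simp only:)
qed

text \<open>Multiplying the series by \<open>1 - x\<close> makes its coefficients absolutely summable, which replaces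
  Abel's theorem at the conditionally convergent boundary point.\<close>
lemma polylog_tendsto_alternating_mzv:
  assumes "0 \<notin> set ss"
  shows "(polylog (1 # ss) \<longlongrightarrow> mzv (-1 # ss)) (at_right (-1))"
proof -
  define b where "b = mzv_term (1 # ss)"
  define d where "d n = b n - (if n = 0 then 0 else b (n - 1))" for n
  let ?p = "length ss"
  have b_Suc: "b (Suc n) = mzv_partial ss (Suc n) / real (Suc n)" for n
    by (simp add: b_def)
  \<comment> \<open>Both parts of the difference gain a second 1/n: one from the new term of the
    inner sum, the other from 1/n - 1/(n+1).\<close>
  have d_bound: "\<bar>d (Suc n)\<bar> \<le> 2 * ((1 + ln (real n)) ^ ?p / real n ^ 2)" if "n \<ge> 1" for n
  proof -
    let ?P = "mzv_partial ss n" and ?t = "mzv_term ss n" and ?L = "(1 + ln (real n)) ^ ?p"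
    have P: "mzv_partial ss (Suc n) = ?P + ?t"
      using mzv_partial_Suc[OF assms, of n] mzv_partial_Suc[OF assms, of "n - 1"] that
      by (cases n) simp_all
    have t: "\<bar>?t\<bar> \<le> ?L / real n"
    proof (cases ss)
      case Nil
      then show ?thesis
        using that by simp
    next
      case (Cons a ss')
      have "\<bar>?t\<bar> \<le> (1 + ln (real n)) ^ length ss' / real n"
        using abs_mzv_term_Cons_le assms Cons by metis
      also have "\<dots> \<le> ?L / real n"
        using Cons one_le_one_plus_ln[of n] by (intro divide_right_mono power_increasing) auto
      finally show ?thesis .
    qed
    have "d (Suc n) = ?t / real (Suc n) - ?P / (real n * real (Suc n))"
    proof -
      have "b n = ?P / real n"
        by (simp add: b_def)
      then have "d (Suc n) = (?P + ?t) / real (Suc n) - ?P / real n"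
        by (simp add: d_def b_Suc P)
      then show ?thesis
        using that by (simp add: divide_simps) (simp add: algebra_simps)
    qed
    also have "\<bar>\<dots>\<bar> \<le> \<bar>?t / real (Suc n)\<bar> + \<bar>?P / (real n * real (Suc n))\<bar>"
      by (rule abs_triangle_ineq4)
    also have "\<bar>?t / real (Suc n)\<bar> \<le> ?L / real n / real n"
      unfolding abs_divide using t that by (intro frac_le) auto
    also have "\<bar>?P / (real n * real (Suc n))\<bar> \<le> ?L / (real n * real n)"
      unfolding abs_divide using abs_mzv_partial_le[OF assms, of n] that
      by (intro frac_le) auto
    finally show ?thesis
      by (simp add: power2_eq_square)
  qed
  have sm: "summable (\<lambda>n. \<bar>d n\<bar>)"
  proof (subst summable_Suc_iff[symmetric], rule summable_comparison_test')
    show "summable (\<lambda>n. 2 * ((1 + ln (real n)) ^ ?p / real n ^ 2))"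
      by (intro summable_mult summable_one_plus_ln_power_div_square)
    show "norm \<bar>d (Suc n)\<bar> \<le> 2 * ((1 + ln (real n)) ^ ?p / real n ^ 2)" if "n \<ge> 1" for n
      using d_bound[OF that] by simp
  qed
  define D where "D x = (\<Sum>n. d n * x ^ n)" for x
  have "continuous_on {-1..1} D"
    unfolding D_def[abs_def] by (rule continuous_on_powser_abs_summable[OF sm])
  then have "(D \<longlongrightarrow> D (-1)) (at (-1) within {-1..1})"
    unfolding continuous_on by (rule bspec) simp
  moreover have "at (-1) within {-1..1} = at_right (-1 :: real)"
    by (rule at_within_Icc_at_right) simp
  ultimately have D_lim: "(D \<longlongrightarrow> D (-1)) (at_right (-1))"
    by (simp only:)
  have "((\<lambda>x. D x / (1 - x)) \<longlongrightarrow> D (-1) / (1 - (-1))) (at_right (-1))"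
    by (intro tendsto_intros D_lim) auto
  moreover have "\<forall>\<^sub>F x in at_right (-1). D x / (1 - x) = polylog (1 # ss) x"
  proof -
    have "D x / (1 - x) = polylog (1 # ss) x" if "-1 < x" "x < 1" for x
    proof -
      have "summable (\<lambda>n. b n * x ^ n)"
        unfolding b_def using assms that by (intro summable_powser_mzv_partial) auto
      from one_minus_times_powser_sums[OF this] have "D x = (1 - x) * polylog (1 # ss) x"
        by (simp add: sums_iff D_def d_def polylog_def b_def)
      then show ?thesis
        using that by simp
    qed
    then show ?thesis
      unfolding eventually_at_right_field by (intro exI[of _ 1]) auto
  qed
  ultimately have "(polylog (1 # ss) \<longlongrightarrow> D (-1) / 2) (at_right (-1))"
    by (simp cong: tendsto_cong) (auto elim: Lim_transform_eventually)
  moreover have "D (-1) / 2 = mzv (-1 # ss)"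
  proof (rule mzv_eqI[symmetric])
    \<comment> \<open>Summation by parts at x = -1: up to a boundary term tending to 0, the partial
      sums for \<open>d\<close> are twice those for \<open>b\<close>. Convergence of the former thus
      yields convergence of the alternating series itself.\<close>
    have part: "(\<Sum>n<Suc N. d n * (-1) ^ n) = 2 * (\<Sum>n<Suc N. b n * (-1) ^ n) - (-1) ^ N * b N" for N
      by (induction N) (simp_all add: d_def algebra_simps)
    have "(\<lambda>N. \<Sum>n<Suc N. d n * (-1) ^ n) \<longlonglongrightarrow> D (-1)"
    proof -
      have "summable (\<lambda>n. d n * (-1) ^ n)"
        by (rule summable_rabs_cancel) (use sm in \<open>simp add: abs_mult power_abs\<close>)
      then show ?thesis
        unfolding D_def by (intro LIMSEQ_Suc summable_LIMSEQ)
    qed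
    moreover have "(\<lambda>N. (-1) ^ N * b N) \<longlonglongrightarrow> 0"
    proof (rule Lim_null_comparison)
      show "\<forall>\<^sub>F N in sequentially. norm ((-1) ^ N * b N) \<le> (1 + ln (real N)) ^ ?p / real N"
        using abs_mzv_term_Cons_le[of 1 ss] assms unfolding b_def
        by (intro always_eventually) (simp add: abs_mult power_abs del: mzv_term.simps)
      show "(\<lambda>N. (1 + ln (real N)) ^ ?p / real N) \<longlonglongrightarrow> 0"
        by real_asymp
    qed
    ultimately have "(\<lambda>N. ((\<Sum>n<Suc N. d n * (-1) ^ n) + (-1) ^ N * b N) / 2) \<longlonglongrightarrow> (D (-1) + 0) / 2"
      by (intro tendsto_intros) auto
    then have "(\<lambda>N. \<Sum>n<Suc N. b n * (-1) ^ n) \<longlonglongrightarrow> D (-1) / 2"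
      unfolding part by (simp del: sum.lessThan_Suc)
    then have "(\<lambda>n. b n * (-1) ^ n) sums (D (-1) / 2)"
      unfolding sums_def by (rule LIMSEQ_imp_Suc)
    moreover have "b n * (-1) ^ n = mzv_term (-1 # ss) n" for n
      by (simp add: b_def)
    ultimately show "mzv_term (-1 # ss) sums (D (-1) / 2)"
      by (simp del: mzv_term.simps)
  qed (use assms in auto)
  ultimately show ?thesis
    by (simp only:)
qed

section \<open>Telescoping sums: derivative and limit\<close>

text \<open>Repeated integration by parts of \<open>\<integral> u\<^sup>M / M! dg\<^sub>0\<close>: the intermediate terms telescope.\<close>
lemma has_real_derivative_telescoping_sum:
  fixes g :: "nat \<Rightarrow> real \<Rightarrow> real" and u :: "real \<Rightarrow> real"
  assumes u: "(u has_real_derivative u') (at y)"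
    and g0: "(g 0 has_real_derivative d) (at y)"
    and gSuc: "\<And>i. i < M \<Longrightarrow> (g (Suc i) has_real_derivative - (g i y * u')) (at y)"
  shows "((\<lambda>y. \<Sum>i\<le>M. u y ^ (M - i) / fact (M - i) * g i y) has_real_derivative
    u y ^ M / fact M * d) (at y)"
proof -
  \<comment> \<open>The product rule yields \<open>a i\<close> from the power of \<open>u\<close> in
    term \<open>i\<close>; the derivative of \<open>g (Suc i)\<close> in the next term cancels
    it.\<close>
  define a where "a i = u y ^ (M - Suc i) / fact (M - Suc i) * g i y * u'" for i
  define g' where "g' i = (case i of 0 \<Rightarrow> d | Suc j \<Rightarrow> - (g j y * u'))" for i
  have g': "(g i has_real_derivative g' i) (at y)" if "i \<le> M" for i
    using that g0 gSuc by (cases i) (auto simp: g'_def)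
  \<comment> \<open>At \<open>i = M\<close> the power of \<open>u\<close> is constant, while
    truncated subtraction makes \<open>a M\<close> equal to \<open>g M y * u'\<close>; hence the
    case distinction.\<close>
  have "((\<lambda>y. u y ^ (M - i) / fact (M - i) * g i y) has_real_derivative
      (if i < M then a i else 0) + u y ^ (M - i) / fact (M - i) * g' i) (at y)" if "i \<le> M" for i
  proof (cases "i < M")
    case True
    then obtain n where n: "M - i = Suc n" "M - Suc i = n"
      by (metis Suc_diff_Suc)
    show ?thesis
      using DERIV_mult[OF has_real_derivative_power_div_fact[OF u, of n] g'[OF that]] True
      by (simp add: n a_def mult_ac add_ac del: power_Suc fact_Suc)
  next
    case False
    with that show ?thesis
      using g'[OF that] by simp
  qed
  then have "((\<lambda>y. \<Sum>i\<le>M. u y ^ (M - i) / fact (M - i) * g i y) has_real_derivative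
      (\<Sum>i\<le>M. (if i < M then a i else 0) + u y ^ (M - i) / fact (M - i) * g' i)) (at y)"
    by (intro DERIV_sum) auto
  also have "(\<Sum>i\<le>M. (if i < M then a i else 0) + u y ^ (M - i) / fact (M - i) * g' i)
      = (\<Sum>i<M. a i) + (\<Sum>i\<le>M. u y ^ (M - i) / fact (M - i) * g' i)"
    by (simp add: sum.distrib flip: lessThan_Suc_atMost)
  also have "(\<Sum>i\<le>M. u y ^ (M - i) / fact (M - i) * g' i) = u y ^ M / fact M * d - (\<Sum>i<M. a i)"
    by (simp add: g'_def a_def sum.lessThan_Suc_shift sum_negf mult_ac del: sum.lessThan_Suc
        flip: lessThan_Suc_atMost)
  finally show ?thesis
    by simp
qed

text \<open>Only the last term survives, since the others carry a positive power of
  \<open>u\<close>. The function \<open>g 0\<close> may diverge, so its product with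
  \<open>u y ^ M\<close> gets a separate hypothesis.\<close>

lemma telescoping_sum_tendsto:
  fixes g :: "nat \<Rightarrow> real \<Rightarrow> real"
  assumes u: "(u \<longlongrightarrow> 0) F"
    and g0: "((\<lambda>y. u y ^ M * g 0 y) \<longlongrightarrow> 0) F"
    and g: "\<And>i. 0 < i \<Longrightarrow> i \<le> M \<Longrightarrow> (g i \<longlongrightarrow> c i) F"
    and "M > 0"
  shows "((\<lambda>y. \<Sum>i\<le>M. u y ^ (M - i) / fact (M - i) * g i y) \<longlongrightarrow> c M) F"
proof -
  have "((\<lambda>y. u y ^ (M - i) / fact (M - i) * g i y) \<longlongrightarrow> (if i = M then c M else 0)) F"
    if i: "i \<le> M" for i
  proof -
    consider "i = 0" | "i = M" | "0 < i" "i < M"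
      using i by linarith
    then show ?thesis
    proof cases
      case 1
      then show ?thesis
        using tendsto_divide[OF g0 tendsto_const[of "fact M"]] \<open>M > 0\<close> by simp
    next
      case 2
      then show ?thesis
        using g[of M] \<open>M > 0\<close> by simp
    next
      case 3
      then have "((\<lambda>y. u y ^ (M - i) / fact (M - i) * g i y) \<longlongrightarrow> 0 ^ (M - i) / fact (M - i) * c i) F"
        by (intro tendsto_intros u g) auto
      then show ?thesis
        using 3 by (simp add: power_0_left)
    qed
  qed
  then have "((\<lambda>y. \<Sum>i\<le>M. u y ^ (M - i) / fact (M - i) * g i y) \<longlongrightarrow>
      (\<Sum>i\<le>M. if i = M then c M else 0)) F"
    by (intro tendsto_sum) auto
  then show ?thesis
    by simp
qed

section \<open>The polylogarithm sum and the alternating sum\<close>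

lemma has_real_derivative_ln_power_weighted_sum:
  fixes M j :: nat
  assumes "0 < z" "z < 1"
  shows "((\<lambda>z. \<Sum>l\<le>M. (- ln z) ^ (M - l) / fact (M - l) * polylog (int (Suc l) # replicate j 1) z)
    has_real_derivative
      (- ln z) ^ M / fact M * ((- ln (1 - z)) ^ j / fact j / (1 - z))) (at z)"
proof (rule has_real_derivative_telescoping_sum)
  show "((\<lambda>z. - ln z) has_real_derivative - (1 / z)) (at z)"
    using assms by (auto intro!: derivative_eq_intros)
  show "(polylog (int (Suc 0) # replicate j 1) has_real_derivative
      (- ln (1 - z)) ^ j / fact j / (1 - z)) (at z)"
    using has_real_derivative_polylog_one[of "replicate j 1" z] polylog_replicate_one[of z j] assms
    by auto
  show "(polylog (int (Suc (Suc i)) # replicate j 1) has_real_derivative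
      - (polylog (int (Suc i) # replicate j 1) z * - (1 / z))) (at z)" for i
    using has_real_derivative_polylog_Suc[of "replicate j 1" "Suc i" z] assms by auto
qed

lemma ln_power_weighted_sum_tendsto:
  assumes "M > 0"
  shows "((\<lambda>y. \<Sum>l\<le>M. (- ln (1 - y)) ^ (M - l) / fact (M - l) *
      polylog (int (Suc l) # replicate j 1) (1 - y)) \<longlongrightarrow>
    mzv (int (Suc M) # replicate j 1)) (at_right 0)"
proof (rule telescoping_sum_tendsto[OF _ _ _ assms])
  show "((\<lambda>y. - ln (1 - y)) \<longlongrightarrow> 0) (at_right (0 :: real))"
    by real_asymp
  \<comment> \<open>An explicit successor exponent shows \<open>real_asymp\<close> that the factor
    decays like a positive power of y, which beats the powers of ln y.\<close>
  obtain p where p: "M = Suc p"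
    using assms gr0_implies_Suc by blast
  have "((\<lambda>y. (- ln (1 - y)) ^ Suc p * ((- ln y) ^ Suc j / fact (Suc j))) \<longlongrightarrow> 0) (at_right (0 :: real))"
    by real_asymp
  moreover have "\<forall>\<^sub>F y in at_right 0. (- ln (1 - y)) ^ Suc p * ((- ln y) ^ Suc j / fact (Suc j)) =
      (- ln (1 - y)) ^ M * polylog (int (Suc 0) # replicate j 1) (1 - y)"
  proof -
    have "polylog (1 # replicate j 1) (1 - y) = (- ln y) ^ Suc j / fact (Suc j)"
      if "0 < y" "y < 1" for y
      using polylog_replicate_one[of "1 - y" "Suc j"] that by simp
    then show ?thesis
      unfolding eventually_at_right_field p by (intro exI[of _ 1]) (auto simp del: power_Suc fact_Suc)
  qed
  ultimately show "((\<lambda>y. (- ln (1 - y)) ^ M * polylog (int (Suc 0) # replicate j 1) (1 - y)) \<longlongrightarrow> 0)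
      (at_right 0)"
    by (rule Lim_transform_eventually)
  show "((\<lambda>y. polylog (int (Suc i) # replicate j 1) (1 - y)) \<longlongrightarrow> mzv (int (Suc i) # replicate j 1))
      (at_right 0)" if "0 < i" for i
  proof (rule filterlim_compose[OF polylog_tendsto_mzv])
    show "filterlim (\<lambda>y :: real. 1 - y) (at_left 1) (at_right 0)"
      by real_asymp
  qed (use that in auto)
qed

text \<open>For x = 2y - 1, 1 - x = 2(1 - y) and 1 + x = 2y; the inner derivative 2 cancels these
  factors 2.\<close>

lemma has_real_derivative_alternating_sum:
  fixes M k :: nat
  assumes "0 < y" "y < 1"
  shows "((\<lambda>y. \<Sum>i\<le>M. ln (1 - y) ^ (M - i) / fact (M - i) *
      polylog (replicate i 1 @ -1 # replicate k 1) (2 * y - 1)) has_real_derivative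
      ln (1 - y) ^ M / fact M * - ((- ln (2 * y)) ^ k / fact k / y)) (at y)"
proof (rule has_real_derivative_telescoping_sum)
  have inner: "((\<lambda>y. 2 * y - 1) has_real_derivative 2) (at y)"
    by (auto intro!: derivative_eq_intros)
  show "((\<lambda>y. ln (1 - y)) has_real_derivative - (1 / (1 - y))) (at y)"
    using assms by (intro has_real_derivative_ln_one_minus) auto
  have "((\<lambda>y. polylog (1 # replicate k 1) (- (2 * y - 1))) has_real_derivative
      polylog (replicate k 1) (- (2 * y - 1)) / (1 - (- (2 * y - 1))) * - 2) (at y)"
    using assms by (intro DERIV_chain2[OF has_real_derivative_polylog_one] DERIV_minus[OF inner]) auto
  then show "((\<lambda>y. polylog (replicate 0 1 @ -1 # replicate k 1) (2 * y - 1)) has_real_derivative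
      - ((- ln (2 * y)) ^ k / fact k / y)) (at y)"
    using assms polylog_replicate_one[of "- (2 * y - 1)" k] by (simp add: polylog_minus_one)
  show "((\<lambda>y. polylog (replicate (Suc i) 1 @ -1 # replicate k 1) (2 * y - 1)) has_real_derivative
      - (polylog (replicate i 1 @ -1 # replicate k 1) (2 * y - 1) * - (1 / (1 - y)))) (at y)" for i
  proof -
    have "((\<lambda>y. polylog (1 # replicate i 1 @ -1 # replicate k 1) (2 * y - 1)) has_real_derivative
        polylog (replicate i 1 @ -1 # replicate k 1) (2 * y - 1) / (1 - (2 * y - 1)) * 2) (at y)"
      using assms by (intro DERIV_chain2[OF has_real_derivative_polylog_one inner]) auto
    moreover have "q / (1 - (2 * y - 1)) * 2 = - (q * - (1 / (1 - y)))" for q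
      using assms by (simp add: field_simps)
    ultimately show ?thesis
      by simp
  qed
qed

text \<open>As y tends to 0 the argument tends to -1, where the leading 1 of the list becomes -1. Of
  the \<open>Suc m\<close> ones in the last term, \<open>m\<close> therefore remain.\<close>

lemma alternating_sum_tendsto:
  fixes m k :: nat
  shows "((\<lambda>y. \<Sum>i\<le>Suc m. ln (1 - y) ^ (Suc m - i) / fact (Suc m - i) *
      polylog (replicate i 1 @ -1 # replicate k 1) (2 * y - 1)) \<longlongrightarrow>
    mzv (-1 # replicate m 1 @ -1 # replicate k 1)) (at_right 0)"
proof -
  have "((\<lambda>y. \<Sum>i\<le>Suc m. ln (1 - y) ^ (Suc m - i) / fact (Suc m - i) *
      polylog (replicate i 1 @ -1 # replicate k 1) (2 * y - 1)) \<longlongrightarrow>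
    mzv (-1 # replicate (Suc m - 1) 1 @ -1 # replicate k 1)) (at_right 0)"
  proof (rule telescoping_sum_tendsto[where M = "Suc m" and u = "\<lambda>y. ln (1 - y)"
        and g = "\<lambda>i y. polylog (replicate i 1 @ -1 # replicate k 1) (2 * y - 1)"
        and c = "\<lambda>i. mzv (-1 # replicate (i - 1) 1 @ -1 # replicate k 1)"])
    show "((\<lambda>y. ln (1 - y)) \<longlongrightarrow> 0) (at_right (0 :: real))"
      by real_asymp
    have "((\<lambda>y. ln (1 - y) ^ Suc m * ((- ln (2 * y)) ^ Suc k / fact (Suc k))) \<longlongrightarrow> 0) (at_right (0 :: real))"
      by real_asymp
    moreover have "\<forall>\<^sub>F y in at_right 0. ln (1 - y) ^ Suc m * ((- ln (2 * y)) ^ Suc k / fact (Suc k)) =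
        ln (1 - y) ^ Suc m * polylog (replicate 0 1 @ -1 # replicate k 1) (2 * y - 1)"
    proof -
      have "polylog (-1 # replicate k 1) (2 * y - 1) = (- ln (2 * y)) ^ Suc k / fact (Suc k)"
        if "0 < y" "y < 1" for y
        using polylog_replicate_one[of "- (2 * y - 1)" "Suc k"] that
        by (simp add: polylog_minus_one)
      then show ?thesis
        unfolding eventually_at_right_field by (intro exI[of _ 1]) (auto simp del: power_Suc fact_Suc)
    qed
    ultimately show "((\<lambda>y. ln (1 - y) ^ Suc m *
        polylog (replicate 0 1 @ -1 # replicate k 1) (2 * y - 1)) \<longlongrightarrow> 0) (at_right 0)"
      by (rule Lim_transform_eventually)
    show "((\<lambda>y. polylog (replicate i 1 @ -1 # replicate k 1) (2 * y - 1)) \<longlongrightarrow>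
        mzv (-1 # replicate (i - 1) 1 @ -1 # replicate k 1)) (at_right 0)" if i: "0 < i" for i
    proof -
      obtain n where "i = Suc n"
        using i gr0_implies_Suc by blast
      moreover have "filterlim (\<lambda>y :: real. 2 * y - 1) (at_right (-1)) (at_right 0)"
        by real_asymp
      then have "((\<lambda>y. polylog (1 # replicate n 1 @ -1 # replicate k 1) (2 * y - 1)) \<longlongrightarrow>
          mzv (-1 # replicate n 1 @ -1 # replicate k 1)) (at_right 0)"
        by (rule filterlim_compose[OF polylog_tendsto_alternating_mzv, rotated]) auto
      ultimately show ?thesis
        by simp
    qed
  qed simp
  then show ?thesis
    by (simp only: diff_Suc_1)
qed

section \<open>Comparison of the two sums\<close>

theorem theorem3p3:
  fixes m k :: nat
  shows "mzv ((-1) # replicate m 1 @ (-1) # replicate k 1) =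
    (-1) ^ (m + k + 1) / fact k *
    (\<Sum>j = 0..k. (-1) ^ j * ln 2 ^ (k - j) * fact j * real (k choose j) *
       (mzv (int (m + 2) # replicate j 1)
        - (\<Sum>l = 0..m + 1. ln 2 ^ (m + 1 - l) / fact (m + 1 - l) *
             Li (Suc l # replicate j 1) (1 / 2))))"
proof -
  define M where "M = Suc m"
  \<comment> \<open>Binomial coefficients of (-ln y - ln 2)^k / k!, rescaled by j! to pair with (-ln
    y)^j / j!.\<close>
  define w where "w j = real (k choose j) * (- ln 2) ^ (k - j) * fact j / fact k" for j
  define T where "T y = (\<Sum>i\<le>M. ln (1 - y) ^ (M - i) / fact (M - i) *
      polylog (replicate i 1 @ -1 # replicate k 1) (2 * y - 1))" for y
  define B where "B j z = (\<Sum>l\<le>M. (- ln z) ^ (M - l) / fact (M - l) *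
      polylog (int (Suc l) # replicate j 1) z)" for j z
  \<comment> \<open>The sign \<open>(-1) ^ M\<close> turns powers of -ln(1 - y) into powers of ln(1
    - y), so that the derivatives cancel.\<close>
  define H where "H y = T y - (-1) ^ M * (\<Sum>j\<le>k. w j * B j (1 - y))" for y
  let ?L = "mzv (-1 # replicate m 1 @ -1 # replicate k 1)"
  let ?Z = "\<lambda>j. mzv (int (Suc M) # replicate j 1)"

  have w_sum: "(\<Sum>j\<le>k. w j * ((- ln y) ^ j / fact j)) = (- ln (2 * y)) ^ k / fact k" if "y > 0" for y
  proof -
    have "(- ln (2 * y)) ^ k = (- ln y + - ln 2) ^ k"
      using that by (simp add: ln_mult add.commute)
    also have "\<dots> = (\<Sum>j\<le>k. real (k choose j) * (- ln y) ^ j * (- ln 2) ^ (k - j))"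
      by (rule binomial_ring)
    finally show ?thesis
      by (simp add: w_def sum_divide_distrib mult_ac)
  qed

  have dH: "(H has_real_derivative 0) (at y)" if y: "0 < y" "y < 1" for y
  proof -
    have dB: "((\<lambda>y. B j (1 - y)) has_real_derivative
        (- ln (1 - y)) ^ M / fact M * ((- ln y) ^ j / fact j / y) * - 1) (at y)" for j
    proof (rule DERIV_chain2[where f = "B j" and g = "\<lambda>y. 1 - y"])
      show "(B j has_real_derivative
          (- ln (1 - y)) ^ M / fact M * ((- ln y) ^ j / fact j / y)) (at (1 - y))"
        using has_real_derivative_ln_power_weighted_sum[of "1 - y" M j] y
        unfolding B_def[abs_def] by simp
      show "((\<lambda>y. 1 - y) has_real_derivative - 1) (at y)"
        by (auto intro!: derivative_eq_intros)
    qed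
    have "(H has_real_derivative
        ln (1 - y) ^ M / fact M * - ((- ln (2 * y)) ^ k / fact k / y) -
        (-1) ^ M * (\<Sum>j\<le>k. w j *
          ((- ln (1 - y)) ^ M / fact M * ((- ln y) ^ j / fact j / y) * - 1))) (at y)"
      unfolding H_def[abs_def] T_def
      by (intro DERIV_diff DERIV_cmult DERIV_sum dB has_real_derivative_alternating_sum y)
    moreover have "(\<Sum>j\<le>k. w j *
          ((- ln (1 - y)) ^ M / fact M * ((- ln y) ^ j / fact j / y) * - 1)) =
        - ((- ln (1 - y)) ^ M / fact M / y) * ((- ln (2 * y)) ^ k / fact k)"
      unfolding w_sum[OF y(1), symmetric] sum_distrib_left by (intro sum.cong) (auto simp: mult_ac)
    moreover have "ln (1 - y) ^ M = (-1) ^ M * (- ln (1 - y)) ^ M"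
      by (simp only: power_mult_distrib[symmetric]) simp
    then have "ln (1 - y) ^ M / fact M * - ((- ln (2 * y)) ^ k / fact k / y) -
        (-1) ^ M * (- ((- ln (1 - y)) ^ M / fact M / y) * ((- ln (2 * y)) ^ k / fact k)) = 0"
      by (simp only:) (simp add: algebra_simps)
    ultimately show ?thesis
      by (simp only:)
  qed

  have "(T \<longlongrightarrow> ?L) (at_right 0)"
    using alternating_sum_tendsto[of m k] unfolding T_def[abs_def] M_def .
  moreover have "((\<lambda>y. B j (1 - y)) \<longlongrightarrow> ?Z j) (at_right 0)" for j
    unfolding B_def by (rule ln_power_weighted_sum_tendsto) (simp add: M_def)
  ultimately have "(H \<longlongrightarrow> ?L - (-1) ^ M * (\<Sum>j\<le>k. w j * ?Z j)) (at_right 0)"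
    unfolding H_def[abs_def]
    by (intro tendsto_diff tendsto_mult tendsto_const tendsto_sum)
  \<comment> \<open>The point 1/2 is where the argument 2y - 1 of \<open>T\<close> is 0 and the
    argument 1 - y of \<open>B\<close> is 1/2.\<close>
  moreover have "(H \<longlongrightarrow> H (1 / 2)) (at_right 0)"
  proof (intro tendsto_eventually eventually_at_rightI)
    show "H y = H (1 / 2)" if "y \<in> {0<..<1}" for y
      using that dH by (intro DERIV_isconst3[of 0 1 y "1 / 2" H]) auto
  qed simp
  ultimately have eq: "?L - (-1) ^ M * (\<Sum>j\<le>k. w j * ?Z j) = H (1 / 2)"
    by (intro tendsto_unique) auto

  have "polylog (replicate i 1 @ -1 # replicate k 1) 0 = 0" for i
    by (cases i) (simp_all add: polylog_0)
  then have "T (1 / 2) = 0"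
    by (simp add: T_def)
  moreover have "B j (1 / 2) = (\<Sum>l = 0..m + 1. ln 2 ^ (m + 1 - l) / fact (m + 1 - l) *
      Li (Suc l # replicate j 1) (1 / 2))" for j
    unfolding B_def by (simp add: Li_eq_polylog ln_div atMost_atLeast0 M_def del: sum.atLeast0_atMost_Suc)
  ultimately have "?L = (-1) ^ M * (\<Sum>j\<le>k. w j * (?Z j -
      (\<Sum>l = 0..m + 1. ln 2 ^ (m + 1 - l) / fact (m + 1 - l) * Li (Suc l # replicate j 1) (1 / 2))))"
    using eq by (simp add: H_def sum_subtractf right_diff_distrib)
  also have "\<dots> = (-1) ^ (m + k + 1) / fact k *
    (\<Sum>j = 0..k. (-1) ^ j * ln 2 ^ (k - j) * fact j * real (k choose j) *
       (mzv (int (m + 2) # replicate j 1)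
        - (\<Sum>l = 0..m + 1. ln 2 ^ (m + 1 - l) / fact (m + 1 - l) *
             Li (Suc l # replicate j 1) (1 / 2))))"
  proof -
    have "(-1) ^ M * w j = (-1) ^ (m + k + 1) / fact k *
        ((-1) ^ j * ln 2 ^ (k - j) * fact j * real (k choose j))" if "j \<le> k" for j
    proof -
      \<comment> \<open>Here k + j and k - j have the same parity, and \<open>M\<close> is m +
        1.\<close>
      have "(-1) ^ (m + k + 1) * (-1) ^ j = (-1) ^ M * ((-1) ^ (k - j) :: real)"
        using that by (auto simp: M_def minus_one_power_iff)
      then show ?thesis
        by (simp add: w_def power_minus[of "ln 2"] mult_ac del: power_Suc)
    qed
    then show ?thesis
      unfolding sum_distrib_left mult.assoc[symmetric] atMost_atLeast0
      by (intro sum.cong) (simp_all add: M_def)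
  qed
  finally show ?thesis .
qed

end
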